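(* Let $n\ge 1$ be an integer. For a uniformly randomly arranged deck with four suits and $n$ cards in each suit, with $M$ the number of matches, $$\mathrm{P}(M=r)=\frac{\alpha_r}{(4n)!/(24)^n},\qquad r=0,1,\dots,3n,$$ where $\alpha_r$ is the number of distinct permutations of the multiset consisting of four copies of each integer $1,\dots,n$ that have exactly $r$ matches.
   Context: The deck has $4n$ distinct cards, one for each pair (suit, rank) with $4$ suits and $n$ ranks; all $(4n)!$ orderings are equally likely. $M$ is the number of indices $i$, $1\le i\le 4n-1$, such that the cards in positions $i$ and $i+1$ have the same rank. A permutation of the multiset is a sequence $(a_1,\dots,a_{4n})$ in which each of $1,\dots,n$ appears exactly four times; its number of matches is the number of indices $i$ with $1\le i\le 4n-1$ and $a_i=a_{i+1}$. *)

theory Defs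
  imports "HOL-Probability.Probability" "HOL-Combinatorics.Multiset_Permutations"
begin

text \<open>A card is a pair (suit, rank).\<close>

definition deck :: "nat \<Rightarrow> (nat \<times> nat) set" where
  "deck n = {1..4} \<times> {1..n}"

definition shuffled_deck :: "nat \<Rightarrow> (nat \<times> nat) list pmf" where
  "shuffled_deck n = pmf_of_set (permutations_of_set (deck n))"

text \<open>
  List positions are 0-based: index \<open>i\<close> below stands for the pair of positions \<open>i + 1\<close>, \<open>i + 2\<close>
  in 1-based counting, so \<open>Suc i < length xs\<close> ranges over all \<open>length xs - 1\<close> adjacent pairs.
\<close>

definition card_matches :: "(nat \<times> nat) list \<Rightarrow> nat" where
  "card_matches cs = card {i. Suc i < length cs \<and> snd (cs ! i) = snd (cs ! Suc i)}"

definition matches :: "nat list \<Rightarrow> nat" where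
  "matches as = card {i. Suc i < length as \<and> as ! i = as ! Suc i}"

definition alpha :: "nat \<Rightarrow> nat \<Rightarrow> nat" where
  "alpha n r =
     card {as \<in> permutations_of_multiset (repeat_mset 4 (mset_set {1..n})). matches as = r}"

end

theory Submission
  imports Defs
begin

text \<open>
  Forgetting the suits (\<open>map snd\<close>) sends an arrangement of the deck to a permutation of the multiset
  and preserves the number of matches. Every permutation \<open>as\<close> of the multiset comes from exactly
  \<open>(4!)\<^sup>n = 24\<^sup>n\<close> arrangements of the deck: independently for each rank, the four cards of that rank are
  distributed over the four positions where \<open>as\<close> has it (\<open>card_permutations_with_map\<close>). Hence
  \<open>alpha n r * 24\<^sup>n\<close> of the \<open>(4 * n)!\<close> equally likely arrangements have exactly \<open>r\<close> matches.
\<close>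

text \<open>
  The elements of \<open>A\<close> with label \<open>b\<close> can be arranged freely among the positions of \<open>as\<close> carrying \<open>b\<close>.
  Reading \<open>as\<close> from the left turns this into an induction: the first label \<open>b\<close> is realised by any
  element of its fibre, and removing that element shrinks only this fibre, by one. The product ranges
  over a fixed \<open>B\<close> containing all labels, because the image of \<open>A\<close> may lose an element when \<open>A\<close> does,
  whereas an empty fibre just contributes the factor \<open>fact 0 = 1\<close>.
\<close>

lemma card_permutations_with_map:
  assumes "finite A" and "finite B" and "f ` A \<subseteq> B"
    and "mset as = image_mset f (mset_set A)"
  shows "card {cs \<in> permutations_of_set A. map f cs = as} = (\<Prod>b\<in>B. fact (card {a \<in> A. f a = b}))"
  using assms
proof (induction as arbitrary: A)
  case Nil
  then have "A = {}" by (metis image_mset_is_empty_iff mset.simps(1) mset_set_empty_iff)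
  then show ?case by (simp add: Collect_conv_if)
next
  case (Cons b bs)
  define F where "F = {a \<in> A. f a = b}"
  define P where "P a = {cs \<in> permutations_of_set (A - {a}). map f cs = bs}" for a
  have "b \<in># image_mset f (mset_set A)"
    by (metis Cons.prems(4) list.set_intros(1) set_mset_mset)
  then have "b \<in> f ` A" using Cons.prems(1) by auto
  then have bB: "b \<in> B" and "F \<noteq> {}"
    using Cons.prems(3) by (auto simp: F_def)
  have finF: "finite F" using Cons.prems(1) by (simp add: F_def)
  with \<open>F \<noteq> {}\<close> have F_pos: "card F > 0" by (simp add: card_gt_0_iff)
  have split: "{cs \<in> permutations_of_set A. map f cs = b # bs} = (\<Union>a\<in>F. (#) a ` P a)"
  proof (intro set_eqI iffI)
    fix cs assume cs: "cs \<in> {cs \<in> permutations_of_set A. map f cs = b # bs}"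
    then obtain a cs' where cs': "cs = a # cs'" "f a = b" "map f cs' = bs"
      by (auto simp: map_eq_Cons_conv)
    with cs have "set (a # cs') = A" "distinct (a # cs')"
      by (simp_all add: permutations_of_set_def)
    then have "a \<in> F" "cs' \<in> P a"
      using cs' by (auto simp: F_def P_def permutations_of_set_def)
    then show "cs \<in> (\<Union>a\<in>F. (#) a ` P a)" using cs'(1) by blast
  next
    fix cs assume "cs \<in> (\<Union>a\<in>F. (#) a ` P a)"
    then obtain a cs' where "a \<in> F" "cs' \<in> P a" "cs = a # cs'" by blast
    then show "cs \<in> {cs \<in> permutations_of_set A. map f cs = b # bs}"
      by (simp add: F_def P_def permutations_of_set_def insert_absorb)
  qed
  have card_P: "card (P a) = fact (card F - 1) * (\<Prod>c\<in>B - {b}. fact (card {a \<in> A. f a = c}))"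
    if "a \<in> F" for a
  proof -
    have a: "a \<in> A" "f a = b" using that by (auto simp: F_def)
    have "add_mset b (mset bs) = add_mset b (image_mset f (mset_set (A - {a})))"
      using Cons.prems(1,4) a by (metis image_mset_add_mset mset.simps(2) mset_set.remove)
    then have "card (P a) = (\<Prod>c\<in>B. fact (card {x \<in> A - {a}. f x = c}))"
      unfolding P_def using Cons.prems by (intro Cons.IH) auto
    also have "\<dots> = fact (card {x \<in> A - {a}. f x = b})
        * (\<Prod>c\<in>B - {b}. fact (card {x \<in> A - {a}. f x = c}))"
      using bB Cons.prems(2) by (simp add: prod.remove)
    also have "{x \<in> A - {a}. f x = b} = F - {a}" by (auto simp: F_def)
    also have "card (F - {a}) = card F - 1" using that by simp
    also have "(\<Prod>c\<in>B - {b}. fact (card {x \<in> A - {a}. f x = c}))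
        = (\<Prod>c\<in>B - {b}. fact (card {x \<in> A. f x = c}))"
      using a(2) by (intro prod.cong arg_cong[where f = "\<lambda>S. fact (card S)"]) auto
    finally show ?thesis .
  qed
  have "card (\<Union>a\<in>F. (#) a ` P a) = (\<Sum>a\<in>F. card ((#) a ` P a))"
    using finF Cons.prems(1) by (intro card_UN_disjoint) (auto simp: P_def)
  also have "\<dots> = (\<Sum>a\<in>F. card (P a))"
    by (intro sum.cong refl card_image) simp
  also have "\<dots> = card F * fact (card F - 1) * (\<Prod>c\<in>B - {b}. fact (card {a \<in> A. f a = c}))"
    using card_P by simp
  also have "card F * fact (card F - 1) = fact (card F)"
    using F_pos using fact_reduce[OF F_pos, where 'a = nat] by simp
  also have "fact (card F) * (\<Prod>c\<in>B - {b}. fact (card {a \<in> A. f a = c}))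
      = (\<Prod>c\<in>B. fact (card {a \<in> A. f a = c}))"
    using bB Cons.prems(2) by (simp add: prod.remove F_def)
  finally show ?case by (simp add: split)
qed

lemma finite_deck: "finite (deck n)"
  by (simp add: deck_def)

lemma card_deck: "card (deck n) = 4 * n"
  by (simp add: deck_def)

lemma card_rank_in_deck:
  assumes "k \<in> {1..n}"
  shows "card {c \<in> deck n. snd c = k} = 4"
proof -
  have "{c \<in> deck n. snd c = k} = {1..4} \<times> {k}"
    using assms by (auto simp: deck_def)
  then show ?thesis by simp
qed

lemma ranks_of_deck: "image_mset snd (mset_set (deck n)) = repeat_mset 4 (mset_set {1..n})"
proof (rule multiset_eqI)
  fix k
  have "count (image_mset snd (mset_set (deck n))) k = card {c \<in> deck n. snd c = k}"
    by (simp add: count_image_mset' finite_deck eq_commute[of k] conj_commute cong: conj_cong)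
  also have "\<dots> = count (repeat_mset 4 (mset_set {1..n})) k"
  proof (cases "k \<in> {1..n}")
    case True
    then show ?thesis using card_rank_in_deck[of k n] by simp
  next
    case False
    then have no_card: "{c \<in> deck n. snd c = k} = {}" by (auto simp: deck_def)
    show ?thesis unfolding no_card using False by simp
  qed
  finally show "count (image_mset snd (mset_set (deck n))) k
      = count (repeat_mset 4 (mset_set {1..n})) k" .
qed

lemma card_matches_eq_matches: "card_matches cs = matches (map snd cs)"
  unfolding card_matches_def matches_def by (intro arg_cong[where f = card]) auto

lemma card_arrangements_with_ranks:
  assumes "as \<in> permutations_of_multiset (repeat_mset 4 (mset_set {1..n}))"
  shows "card {cs \<in> permutations_of_set (deck n). map snd cs = as} = 24 ^ n"
proof -
  have "card {cs \<in> permutations_of_set (deck n). map snd cs = as}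
      = (\<Prod>k\<in>{1..n}. fact (card {c \<in> deck n. snd c = k}))"
  proof (rule card_permutations_with_map)
    show "snd ` deck n \<subseteq> {1..n}" by (auto simp: deck_def)
    show "mset as = image_mset snd (mset_set (deck n))"
      using assms by (simp only: ranks_of_deck permutations_of_multisetD)
  qed (simp_all add: finite_deck)
  also have "\<dots> = (\<Prod>k\<in>{1..n}. fact 4)"
    by (intro prod.cong refl) (simp only: card_rank_in_deck)
  also have "\<dots> = 24 ^ n" by (simp add: fact_numeral)
  finally show ?thesis .
qed

lemma card_arrangements_with_matches:
  "card {cs \<in> permutations_of_set (deck n). card_matches cs = r} = alpha n r * 24 ^ n"
proof -
  define R where
    "R = {as \<in> permutations_of_multiset (repeat_mset 4 (mset_set {1..n})). matches as = r}"
  define D where "D as = {cs \<in> permutations_of_set (deck n). map snd cs = as}" for as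
  have "map snd cs \<in> permutations_of_multiset (repeat_mset 4 (mset_set {1..n}))"
    if "cs \<in> permutations_of_set (deck n)" for cs
  proof -
    have "mset cs = mset_set (deck n)"
      using that by (metis mset_set_set permutations_of_setD)
    then have "mset (map snd cs) = repeat_mset 4 (mset_set {1..n})"
      by (simp only: mset_map ranks_of_deck)
    then show ?thesis by (rule permutations_of_multisetI)
  qed
  then have split: "{cs \<in> permutations_of_set (deck n). card_matches cs = r} = (\<Union>as\<in>R. D as)"
    by (auto simp: R_def D_def card_matches_eq_matches)
  have "card (\<Union>as\<in>R. D as) = (\<Sum>as\<in>R. card (D as))"
    by (intro card_UN_disjoint) (auto simp: R_def D_def)
  also have "\<dots> = (\<Sum>as\<in>R. 24 ^ n)"
    by (intro sum.cong refl) (simp add: R_def D_def card_arrangements_with_ranks)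
  also have "\<dots> = alpha n r * 24 ^ n"
    by (simp add: R_def alpha_def)
  finally show ?thesis by (simp add: split)
qed

theorem corollary4:
  fixes n r :: nat
  assumes "n \<ge> 1" and "r \<le> 3 * n"
  shows "measure_pmf.prob (shuffled_deck n) {cs. card_matches cs = r}
           = real (alpha n r) / (fact (4 * n) / 24 ^ n)"
proof -
  have "permutations_of_set (deck n) \<inter> {cs. card_matches cs = r}
      = {cs \<in> permutations_of_set (deck n). card_matches cs = r}"
    by auto
  then have "measure_pmf.prob (shuffled_deck n) {cs. card_matches cs = r}
      = real (alpha n r * 24 ^ n) / real (card (permutations_of_set (deck n)))"
    by (simp add: shuffled_deck_def measure_pmf_of_set finite_deck card_arrangements_with_matches)
  also have "\<dots> = real (alpha n r) / (fact (4 * n) / 24 ^ n)"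
    by (simp add: finite_deck card_deck)
  finally show ?thesis .
qed

end
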